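(* Let $R$ and $S$ be TRSs over disjoint ranked alphabets $\Sigma$ and $\Delta$, respectively, such that no left-hand side of a rule of $R\oplus S$ is a variable. If $R\oplus S$ is an EPRF-TRS, then $R$ and $S$ are also EPRF-TRSs.
   Context: A ranked alphabet is a finite set of symbols with ranks; $X$ a countable set of variables, $T_\Sigma(X)$ the terms, $T_\Sigma$ the ground terms. A TRS over $\Sigma$ is a finite set of rules $l\to r$, $l,r\in T_\Sigma(X)$, with every variable of $r$ occurring in $l$; $sign(R)$ is the set of symbols in its rules. For TRSs $R$, $S$ over disjoint alphabets $\Sigma$, $\Delta$, $R\oplus S$ is the TRS $R\cup S$ over $\Sigma\cup\Delta$. $R^*_\Gamma(L)=\{p\mid q\Rightarrow^*_R p,\ q\in L\}$. A bottom-up tree automaton (bta) over $\Gamma$ is a finite automaton with states (treated as constants), final states, rules $\delta(a_1,\dots,a_n)\to a$ and $a\to a'$, recognizing the ground terms rewriting to a final state. $R$ is an EPRF-TRS if for any given ranked alphabet $\Gamma\supseteq sign(R)$ and finite $L\subseteq T_\Gamma$ one can effectively construct a bta $\mathcal{C}$ over $\Gamma$ with $L(\mathcal{C})=R^*_\Gamma(L)$. *)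

theory Defs
  imports Main "HOL-Library.Nat_Bijection"
begin

section \<open>Terms and rewriting\<close>

datatype (funs: 'f, vars: 'v) trm =
    is_Var: Var 'v
  | Fun 'f "('f, 'v) trm list"

fun subst :: "('v \<Rightarrow> ('f, 'v) trm) \<Rightarrow> ('f, 'v) trm \<Rightarrow> ('f, 'v) trm" where
  "subst \<sigma> (Var x) = \<sigma> x"
| "subst \<sigma> (Fun f ts) = Fun f (map (subst \<sigma>) ts)"

inductive_set rstep :: "(('f, 'v) trm \<times> ('f, 'v) trm) set \<Rightarrow> (('f, 'v) trm \<times> ('f, 'v) trm) set"
  for R where
  root: "(l, r) \<in> R \<Longrightarrow> (subst \<sigma> l, subst \<sigma> r) \<in> rstep R"
| arg: "(s, t) \<in> rstep R \<Longrightarrow> (Fun f (us @ s # vs), Fun f (us @ t # vs)) \<in> rstep R"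

text \<open>Symbols are drawn from a fixed countable universe containing infinitely many symbols of
  each rank: a symbol is a pair of a name and a rank. Two pairs with the same name and different
  ranks are different symbols, so every symbol has exactly one rank.\<close>

type_synonym symbol = "nat \<times> nat"

definition rank :: "symbol \<Rightarrow> nat" where
  "rank f = snd f"

definition ranked_alphabet :: "symbol set \<Rightarrow> bool" where
  "ranked_alphabet \<Gamma> \<longleftrightarrow> finite \<Gamma>"

inductive_set terms :: "symbol set \<Rightarrow> (symbol, nat) trm set"
  for \<Gamma> where
  Var: "Var x \<in> terms \<Gamma>"
| Fun: "f \<in> \<Gamma> \<Longrightarrow> length ts = rank f \<Longrightarrow> (\<And>t. t \<in> set ts \<Longrightarrow> t \<in> terms \<Gamma>) \<Longrightarrow> Fun f ts \<in> terms \<Gamma>"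

definition ground_terms :: "symbol set \<Rightarrow> (symbol, nat) trm set" where
  "ground_terms \<Gamma> = {t \<in> terms \<Gamma>. vars t = {}}"

type_synonym trs = "((symbol, nat) trm \<times> (symbol, nat) trm) set"

definition is_trs :: "symbol set \<Rightarrow> trs \<Rightarrow> bool" where
  "is_trs \<Sigma> R \<longleftrightarrow> finite R \<and>
     (\<forall>(l, r) \<in> R. l \<in> terms \<Sigma> \<and> r \<in> terms \<Sigma> \<and> vars r \<subseteq> vars l)"

definition sign :: "trs \<Rightarrow> symbol set" where
  "sign R = (\<Union>(l, r) \<in> R. funs l \<union> funs r)"

definition descendants :: "symbol set \<Rightarrow> trs \<Rightarrow> (symbol, nat) trm set \<Rightarrow> (symbol, nat) trm set" where
  "descendants \<Gamma> R L = {p \<in> ground_terms \<Gamma>. \<exists>q \<in> L. (q, p) \<in> (rstep R)\<^sup>*}"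

section \<open>Bottom-up tree automata\<close>

text \<open>\<open>Trans \<delta> [a\<^sub>1, \<dots>, a\<^sub>n] a\<close> is the rule \<open>\<delta>(a\<^sub>1, \<dots>, a\<^sub>n) \<rightarrow> a\<close>.\<close>

datatype bta_rule = Trans symbol "nat list" nat | Eps nat nat

record bta =
  states :: "nat set"
  rules :: "bta_rule set"
  finals :: "nat set"

fun rule_over :: "symbol set \<Rightarrow> nat set \<Rightarrow> bta_rule \<Rightarrow> bool" where
  "rule_over \<Gamma> Q (Trans f qs q) \<longleftrightarrow> f \<in> \<Gamma> \<and> length qs = rank f \<and> set qs \<subseteq> Q \<and> q \<in> Q"
| "rule_over \<Gamma> Q (Eps q q') \<longleftrightarrow> q \<in> Q \<and> q' \<in> Q"

definition bta_over :: "symbol set \<Rightarrow> bta \<Rightarrow> bool" where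
  "bta_over \<Gamma> C \<longleftrightarrow> finite (states C) \<and> finite (rules C) \<and> finals C \<subseteq> states C \<and>
     (\<forall>\<rho> \<in> rules C. rule_over \<Gamma> (states C) \<rho>)"

text \<open>An automaton is a ground rewrite system on terms over the disjoint sum of the alphabet
  and the states, the latter being constants.\<close>

definition state_trm :: "nat \<Rightarrow> (symbol + nat, nat) trm" where
  "state_trm q = Fun (Inr q) []"

fun rule_pair :: "bta_rule \<Rightarrow> (symbol + nat, nat) trm \<times> (symbol + nat, nat) trm" where
  "rule_pair (Trans f qs q) = (Fun (Inl f) (map state_trm qs), state_trm q)"
| "rule_pair (Eps q q') = (state_trm q, state_trm q')"

definition bta_lang :: "symbol set \<Rightarrow> bta \<Rightarrow> (symbol, nat) trm set" where
  "bta_lang \<Gamma> C = {t \<in> ground_terms \<Gamma>.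
     \<exists>q \<in> finals C. (map_trm Inl id t, state_trm q) \<in> (rstep (rule_pair ` rules C))\<^sup>*}"

section \<open>Effective constructions\<close>

text \<open>\<open>recursive_fun n f\<close>: the function \<open>f\<close>, restricted to argument lists of length \<open>n\<close>, is a total
  recursive function. The class of total recursive functions is generated from the basic functions
  by composition, primitive recursion and minimization of regular functions.\<close>

inductive recursive_fun :: "nat \<Rightarrow> (nat list \<Rightarrow> nat) \<Rightarrow> bool" where
  zero: "recursive_fun n (\<lambda>xs. 0)"
| succ: "recursive_fun 1 (\<lambda>xs. Suc (xs ! 0))"
| proj: "i < n \<Longrightarrow> recursive_fun n (\<lambda>xs. xs ! i)"
| comp: "recursive_fun (length gs) f \<Longrightarrow> (\<forall>g \<in> set gs. recursive_fun n g) \<Longrightarrow>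
    recursive_fun n (\<lambda>xs. f (map (\<lambda>g. g xs) gs))"
| prim: "recursive_fun n g \<Longrightarrow> recursive_fun (Suc (Suc n)) h \<Longrightarrow>
    recursive_fun (Suc n) (\<lambda>xs. rec_nat (g (tl xs)) (\<lambda>k y. h (k # y # tl xs)) (hd xs))"
| minim: "recursive_fun (Suc n) f \<Longrightarrow> (\<forall>xs. length xs = n \<longrightarrow> (\<exists>y. f (y # xs) = 0)) \<Longrightarrow>
    recursive_fun n (\<lambda>xs. LEAST y. f (y # xs) = 0)"

definition computable :: "(nat \<Rightarrow> nat) \<Rightarrow> bool" where
  "computable f \<longleftrightarrow> (\<exists>g. recursive_fun 1 g \<and> (\<forall>x. f x = g [x]))"

text \<open>A finite set is presented by a list of the codes of its elements, in any order and possibly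
  with repetitions.\<close>

definition set_code :: "('a \<Rightarrow> nat) \<Rightarrow> 'a set \<Rightarrow> nat \<Rightarrow> bool" where
  "set_code enc A c \<longleftrightarrow> (\<exists>xs. set xs = A \<and> c = list_encode (map enc xs))"

text \<open>Ground terms are presented in Polish notation, which is uniquely readable because symbols
  carry their ranks. The equation for variables is a dummy.\<close>

fun polish :: "('f, 'v) trm \<Rightarrow> 'f list" where
  "polish (Var x) = []"
| "polish (Fun f ts) = f # concat (map polish ts)"

definition ground_code :: "(symbol, nat) trm \<Rightarrow> nat" where
  "ground_code t = list_encode (map prod_encode (polish t))"

fun rule_code :: "bta_rule \<Rightarrow> nat" where
  "rule_code (Trans f qs q) =
     sum_encode (Inl (prod_encode (prod_encode f, prod_encode (list_encode qs, q))))"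
| "rule_code (Eps q q') = sum_encode (Inr (prod_encode (q, q')))"

definition input_code :: "symbol set \<Rightarrow> (symbol, nat) trm set \<Rightarrow> nat \<Rightarrow> bool" where
  "input_code \<Gamma> L c \<longleftrightarrow> (\<exists>a b. set_code prod_encode \<Gamma> a \<and> set_code ground_code L b \<and>
     c = prod_encode (a, b))"

definition bta_code :: "bta \<Rightarrow> nat \<Rightarrow> bool" where
  "bta_code C c \<longleftrightarrow> (\<exists>a b d. set_code id (states C) a \<and> set_code rule_code (rules C) b \<and>
     set_code id (finals C) d \<and> c = prod_encode (a, prod_encode (b, d)))"

text \<open>Valid inputs form a decidable set, so requiring the algorithm to halt on valid inputs only
  would define the same notion.\<close>

definition EPRF :: "trs \<Rightarrow> bool" where
  "EPRF R \<longleftrightarrow> (\<exists>F. computable F \<and>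
     (\<forall>\<Gamma> L c. ranked_alphabet \<Gamma> \<and> sign R \<subseteq> \<Gamma> \<and> finite L \<and> L \<subseteq> ground_terms \<Gamma> \<and>
        input_code \<Gamma> L c \<longrightarrow>
        (\<exists>C. bta_over \<Gamma> C \<and> bta_code C (F c) \<and> bta_lang \<Gamma> C = descendants \<Gamma> R L)))"

end

theory Submission
  imports Defs
begin

text \<open>Given an alphabet \<open>\<Gamma>\<close> and a finite \<open>L\<close>, rename every symbol outside \<open>sign R\<close> to one outside
  \<open>sign S\<close> and enlarge the alphabet by \<open>sign S\<close>. As left-hand sides of \<open>S\<close> are not variables, no
  rule of \<open>S\<close> applies to a descendant of the renamed \<open>L\<close>, so its descendants under \<open>R \<union> S\<close> are the
  renamed descendants of \<open>L\<close> under \<open>R\<close>. The automaton for \<open>R \<union> S\<close> becomes one for \<open>R\<close> by undoing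
  the renaming and neutralizing the transitions on symbols of \<open>S\<close>. Both translations act
  elementwise on codes of lists, hence are recursive.\<close>

section \<open>Recursive functions on codes\<close>

text \<open>Whether a function satisfies \<open>recursive_fun n\<close> also depends on its junk values on lists of
  length other than \<open>n\<close>; \<open>recursive n\<close> disregards them.\<close>

definition recursive :: "nat \<Rightarrow> (nat list \<Rightarrow> nat) \<Rightarrow> bool" where
  "recursive n f \<longleftrightarrow> (\<exists>g. recursive_fun n g \<and> (\<forall>xs. length xs = n \<longrightarrow> f xs = g xs))"

lemma recursive_cong:
  "recursive n f \<Longrightarrow> (\<And>xs. length xs = n \<Longrightarrow> f xs = g xs) \<Longrightarrow> recursive n g"
  unfolding recursive_def by metis

lemma computable_iff_recursive: "computable f \<longleftrightarrow> recursive 1 (\<lambda>xs. f (xs ! 0))"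
proof
  assume "computable f"
  then obtain g where "recursive_fun 1 g" "\<forall>x. f x = g [x]"
    unfolding computable_def by blast
  then show "recursive 1 (\<lambda>xs. f (xs ! 0))"
    unfolding recursive_def by (auto intro!: exI[of _ g] simp: length_Suc_conv)
next
  assume "recursive 1 (\<lambda>xs. f (xs ! 0))"
  then obtain g where g: "recursive_fun 1 g" "\<forall>xs. length xs = 1 \<longrightarrow> f (xs ! 0) = g xs"
    unfolding recursive_def by blast
  have "f x = g [x]" for x using g(2)[rule_format, of "[x]"] by simp
  with g(1) show "computable f" unfolding computable_def by blast
qed

section \<open>Closure under composition, primitive recursion and minimization\<close>

lemma recursive_proj: "i < n \<Longrightarrow> recursive n (\<lambda>xs. xs ! i)"
  unfolding recursive_def using recursive_fun.proj by blast

lemma recursive_comp: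
  assumes "recursive (length gs) f" "\<forall>g \<in> set gs. recursive n g"
  shows "recursive n (\<lambda>xs. f (map (\<lambda>g. g xs) gs))"
proof -
  obtain f' where f': "recursive_fun (length gs) f'" "\<forall>xs. length xs = length gs \<longrightarrow> f xs = f' xs"
    using assms(1) unfolding recursive_def by blast
  obtain G where G: "\<forall>g \<in> set gs. recursive_fun n (G g) \<and> (\<forall>xs. length xs = n \<longrightarrow> g xs = G g xs)"
    using assms(2) unfolding recursive_def by metis
  have "recursive_fun n (\<lambda>xs. f' (map (\<lambda>g. g xs) (map G gs)))"
    using G f'(1) by (intro recursive_fun.comp) auto
  moreover have "f (map (\<lambda>g. g xs) gs) = f' (map (\<lambda>g. g xs) (map G gs))" if "length xs = n" for xs
  proof -
    have "map (\<lambda>g. g xs) gs = map (\<lambda>g. g xs) (map G gs)"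
      using G that by simp
    then show ?thesis using f'(2) by (metis length_map)
  qed
  ultimately show ?thesis unfolding recursive_def by blast
qed

lemma recursive_comp1:
  assumes "computable h" "recursive n f"
  shows "recursive n (\<lambda>xs. h (f xs))"
  using recursive_comp[of "[f]" "\<lambda>xs. h (xs ! 0)" n] assms by (simp add: computable_iff_recursive)

lemma recursive_comp2:
  assumes "recursive 2 (\<lambda>xs. h (xs ! 0) (xs ! 1))" "recursive n f" "recursive n g"
  shows "recursive n (\<lambda>xs. h (f xs) (g xs))"
  using recursive_comp[of "[f, g]" "\<lambda>xs. h (xs ! 0) (xs ! 1)" n] assms by (simp add: numeral_2_eq_2)

lemma recursive_Suc:
  assumes "recursive n f"
  shows "recursive n (\<lambda>xs. Suc (f xs))"
proof -
  have "computable Suc"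
    unfolding computable_iff_recursive recursive_def using recursive_fun.succ by blast
  then show ?thesis using assms by (rule recursive_comp1)
qed

lemma recursive_const: "recursive n (\<lambda>xs. c)"
proof (induction c)
  case 0
  show ?case unfolding recursive_def using recursive_fun.zero by blast
qed (rule recursive_Suc)

lemma recursive_prim:
  assumes "recursive n g" "recursive (Suc (Suc n)) h"
  shows "recursive (Suc n) (\<lambda>xs. rec_nat (g (tl xs)) (\<lambda>k y. h (k # y # tl xs)) (hd xs))"
proof -
  obtain g' where g': "recursive_fun n g'" "\<And>xs. length xs = n \<Longrightarrow> g xs = g' xs"
    using assms(1) unfolding recursive_def by blast
  obtain h' where h': "recursive_fun (Suc (Suc n)) h'"
    "\<And>xs. length xs = Suc (Suc n) \<Longrightarrow> h xs = h' xs"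
    using assms(2) unfolding recursive_def by blast
  show ?thesis
    unfolding recursive_def
  proof (intro exI conjI allI impI)
    show "recursive_fun (Suc n)
        (\<lambda>xs. rec_nat (g' (tl xs)) (\<lambda>k y. h' (k # y # tl xs)) (hd xs))"
      using g'(1) h'(1) by (rule recursive_fun.prim)
  qed (simp add: g'(2) h'(2))
qed

lemma recursive_rec_nat1:
  assumes "recursive 2 (\<lambda>xs. h (xs ! 0) (xs ! 1))"
  shows "computable (rec_nat a h)"
proof -
  have "recursive (Suc 0) (\<lambda>xs. rec_nat a (\<lambda>k y. h ((k # y # tl xs) ! 0) ((k # y # tl xs) ! 1)) (hd xs))"
    using assms by (intro recursive_prim recursive_const) (simp add: numeral_2_eq_2)
  then show ?thesis
    unfolding computable_iff_recursive by (auto elim!: recursive_cong simp: length_Suc_conv)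
qed

text \<open>The recursion argument comes first and the parameter second; the step \<open>h\<close>
  receives counter, previous value and parameter in this order.\<close>

lemma recursive_rec_nat2:
  assumes "computable g" "recursive 3 (\<lambda>xs. h (xs ! 0) (xs ! 1) (xs ! 2))"
  shows "recursive 2 (\<lambda>xs. rec_nat (g (xs ! 1)) (\<lambda>k y. h k y (xs ! 1)) (xs ! 0))"
proof -
  have "recursive (Suc 1) (\<lambda>xs. rec_nat (g (tl xs ! 0))
      (\<lambda>k y. h ((k # y # tl xs) ! 0) ((k # y # tl xs) ! 1) ((k # y # tl xs) ! 2)) (hd xs))"
    using assms by (intro recursive_prim) (simp_all add: computable_iff_recursive numeral_3_eq_3)
  then show ?thesis
    by (auto elim!: recursive_cong simp: length_Suc_conv numeral_2_eq_2)
qed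

lemma recursive_Least:
  assumes "recursive 2 (\<lambda>xs. f (xs ! 0) (xs ! 1))" "\<And>x. \<exists>y. f y x = 0"
  shows "computable (\<lambda>x. LEAST y. f y x = 0)"
proof -
  obtain g where g: "recursive_fun 2 g" "\<And>xs. length xs = 2 \<Longrightarrow> f (xs ! 0) (xs ! 1) = g xs"
    using assms(1) unfolding recursive_def by blast
  have g': "g [y, x] = f y x" for x y
    using g(2)[of "[y, x]"] by simp
  have "recursive_fun 1 (\<lambda>xs. LEAST y. g (y # xs) = 0)"
    using g(1) assms(2) by (intro recursive_fun.minim) (auto simp: length_Suc_conv g' numeral_2_eq_2)
  then show ?thesis
    unfolding computable_def by (intro exI conjI) (auto simp: g')
qed

lemma recursive_if_zero:
  assumes "recursive n c" "recursive n a" "recursive n b"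
  shows "recursive n (\<lambda>xs. if c xs = 0 then a xs else b xs)"
proof -
  \<comment> \<open>Recursion over the condition, ignoring the previous value: in a successor step,
    position 3 of \<open>k # y # tl xs\<close> is the value of \<open>b\<close>.\<close>
  let ?ite = "\<lambda>xs. rec_nat (tl xs ! 0) (\<lambda>k y. (k # y # tl xs) ! 3) (hd xs)"
  have "recursive (Suc 2) ?ite"
    by (intro recursive_prim recursive_proj) auto
  then have "recursive n (\<lambda>xs. ?ite (map (\<lambda>g. g xs) [c, a, b]))"
    using assms by (intro recursive_comp) (auto simp: numeral_2_eq_2)
  moreover have "?ite [x, y, z] = (if x = 0 then y else z)" for x y z :: nat
    by (cases x) auto
  ultimately show ?thesis by simp
qed

lemma recursive_add:
  assumes "recursive n f" "recursive n g"
  shows "recursive n (\<lambda>xs. f xs + g xs)"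
proof -
  have "computable (\<lambda>x. x)"
    unfolding computable_iff_recursive by (intro recursive_proj) simp
  then have "recursive 2 (\<lambda>xs. rec_nat (xs ! 1) (\<lambda>k y. Suc y) (xs ! 0))"
    by (rule recursive_rec_nat2) (intro recursive_Suc recursive_proj, simp)
  moreover have "rec_nat y (\<lambda>k y. Suc y) x = x + y" for x y :: nat
    by (induction x) auto
  ultimately show ?thesis
    using recursive_comp2[of "(+)"] assms by simp
qed

lemma recursive_pred:
  assumes "recursive n f"
  shows "recursive n (\<lambda>xs. f xs - 1)"
proof -
  have "computable (rec_nat 0 (\<lambda>k y. k))"
    by (intro recursive_rec_nat1 recursive_proj) simp
  moreover have "rec_nat 0 (\<lambda>k y. k) x = x - 1" for x :: nat
    by (cases x) auto
  ultimately show ?thesis using recursive_comp1 assms by fastforce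
qed

lemma recursive_diff:
  assumes "recursive n f" "recursive n g"
  shows "recursive n (\<lambda>xs. f xs - g xs)"
proof -
  have "computable (\<lambda>x. x)"
    unfolding computable_iff_recursive by (intro recursive_proj) simp
  then have "recursive 2 (\<lambda>xs. rec_nat (xs ! 1) (\<lambda>k y. y - 1) (xs ! 0))"
    by (rule recursive_rec_nat2) (intro recursive_pred recursive_proj, simp)
  moreover have "rec_nat y (\<lambda>k y. y - 1) x = y - x" for x y :: nat
    by (induction x) auto
  ultimately show ?thesis
    using recursive_comp2[of "\<lambda>x y. y - x"] assms by simp
qed

lemma recursive_triangle:
  assumes "recursive n f"
  shows "recursive n (\<lambda>xs. triangle (f xs))"
proof -
  have "computable (rec_nat 0 (\<lambda>k y. y + Suc k))"
    by (intro recursive_rec_nat1 recursive_add recursive_Suc recursive_proj) simp_all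
  moreover have "rec_nat 0 (\<lambda>k y. y + Suc k) x = triangle x" for x
    by (induction x) auto
  ultimately show ?thesis using recursive_comp1 assms by fastforce
qed

section \<open>Cantor pairing and its projections\<close>

lemma recursive_prod_encode:
  "recursive n f \<Longrightarrow> recursive n g \<Longrightarrow> recursive n (\<lambda>xs. prod_encode (f xs, g xs))"
  unfolding prod_encode_def by (simp add: recursive_add recursive_triangle)

text \<open>The diagonal on which the pair coded by \<open>x\<close> lies.\<close>

definition prod_diag :: "nat \<Rightarrow> nat" where
  "prod_diag x = (LEAST w. Suc x - triangle (Suc w) = 0)"

text \<open>\<open>prod_encode (a, b)\<close> is \<open>triangle (a + b) + a\<close>, which lies
  below \<open>triangle (Suc (a + b))\<close> but not below \<open>triangle (a + b)\<close>;
  \<open>Suc x - y = 0\<close> expresses \<open>x < y\<close>.\<close>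

lemma prod_diag_prod_encode: "prod_diag (prod_encode (a, b)) = a + b"
proof -
  have mono: "triangle i \<le> triangle j" if "i \<le> j" for i j
    using that by (induction rule: dec_induct) auto
  show ?thesis
    unfolding prod_diag_def
  proof (rule Least_equality)
    show "Suc (prod_encode (a, b)) - triangle (Suc (a + b)) = 0"
      by (simp add: prod_encode_def)
  next
    fix w assume w: "Suc (prod_encode (a, b)) - triangle (Suc w) = 0"
    show "a + b \<le> w"
    proof (rule ccontr)
      assume "\<not> a + b \<le> w"
      then have "triangle (Suc w) \<le> triangle (a + b)" by (intro mono) simp
      with w show False by (simp add: prod_encode_def)
    qed
  qed
qed

lemma recursive_prod_diag:
  assumes "recursive n f"
  shows "recursive n (\<lambda>xs. prod_diag (f xs))"
proof -
  have "computable (\<lambda>x. LEAST w. Suc x - triangle (Suc w) = 0)"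
  proof (rule recursive_Least)
    show "recursive 2 (\<lambda>xs. Suc (xs ! 1) - triangle (Suc (xs ! 0)))"
      by (intro recursive_diff recursive_Suc recursive_triangle recursive_proj) simp_all
    show "\<exists>w. Suc x - triangle (Suc w) = 0" for x
      by (rule exI[of _ x]) simp
  qed
  then show ?thesis unfolding prod_diag_def using assms by (rule recursive_comp1)
qed

text \<open>With the diagonal at hand, both projections become truncated differences of recursive
  functions.\<close>

lemma fst_prod_decode: "fst (prod_decode x) = x - triangle (prod_diag x)"
proof -
  obtain a b where x: "x = prod_encode (a, b)" by (metis prod_decode_inverse surj_pair)
  then have "x = triangle (prod_diag x) + a"
    unfolding prod_diag_prod_encode x by (simp add: prod_encode_def)
  with x show ?thesis by simp
qed

lemma snd_prod_decode: "snd (prod_decode x) = prod_diag x - fst (prod_decode x)"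
proof -
  obtain a b where x: "x = prod_encode (a, b)" by (metis prod_decode_inverse surj_pair)
  then show ?thesis by (simp add: prod_diag_prod_encode)
qed

lemma recursive_fst: "recursive n f \<Longrightarrow> recursive n (\<lambda>xs. fst (prod_decode (f xs)))"
  unfolding fst_prod_decode by (intro recursive_diff recursive_triangle recursive_prod_diag)

lemma recursive_snd: "recursive n f \<Longrightarrow> recursive n (\<lambda>xs. snd (prod_decode (f xs)))"
  unfolding snd_prod_decode by (intro recursive_diff recursive_fst recursive_prod_diag)

lemma recursive_div2:
  assumes "recursive n f"
  shows "recursive n (\<lambda>xs. f xs div 2)"
proof -
  \<comment> \<open>\<open>x div 2\<close> is the least \<open>y\<close> with
    \<open>x \<le> 2 * y + 1\<close>, which the truncated difference tests.\<close>
  have "computable (\<lambda>x. LEAST y. x - Suc (y + y) = 0)"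
  proof (rule recursive_Least)
    show "recursive 2 (\<lambda>xs. xs ! 1 - Suc (xs ! 0 + xs ! 0))"
      by (intro recursive_diff recursive_add recursive_Suc recursive_proj) simp_all
    show "\<exists>y. x - Suc (y + y) = 0" for x
      by (rule exI[of _ x]) simp
  qed
  moreover have "(LEAST y. x - Suc (y + y) = 0) = x div 2" for x :: nat
    by (rule Least_equality) auto
  ultimately show ?thesis using recursive_comp1 assms by fastforce
qed

text \<open>Parity is the tag by which \<open>sum_encode\<close> distinguishes \<open>Inl\<close>
  from \<open>Inr\<close>.\<close>

lemma recursive_if_even:
  assumes "recursive n c" "recursive n a" "recursive n b"
  shows "recursive n (\<lambda>xs. if even (c xs) then a xs else b xs)"
proof -
  have "recursive n (\<lambda>xs. if c xs - (c xs div 2 + c xs div 2) = 0 then a xs else b xs)"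
    using assms by (intro recursive_if_zero recursive_diff recursive_add recursive_div2)
  moreover have "x - (x div 2 + x div 2) = 0 \<longleftrightarrow> even x" for x :: nat
    by presburger
  ultimately show ?thesis by simp
qed

text \<open>A finite set can be hard-wired as a chain of equality tests; this serves to test
  membership in \<open>sign R\<close> and \<open>sign S\<close> on codes.\<close>

lemma recursive_if_mem:
  assumes "finite A" "recursive n c" "recursive n a" "recursive n b"
  shows "recursive n (\<lambda>xs. if c xs \<in> A then a xs else b xs)"
  using assms(1)
proof (induction A rule: finite_induct)
  case (insert x A)
  \<comment> \<open>The sum of the two truncated differences vanishes exactly when
    \<open>c xs = x\<close>.\<close>
  have "recursive n (\<lambda>xs. if (c xs - x) + (x - c xs) = 0 then a xs
      else if c xs \<in> A then a xs else b xs)"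
    using assms insert.IH
    by (intro recursive_if_zero recursive_diff recursive_add recursive_const)
  then show ?case by (rule recursive_cong) auto
qed (simp add: assms)

lemmas recursive_intros =
  recursive_Suc recursive_add recursive_diff recursive_pred recursive_prod_encode
  recursive_fst recursive_snd recursive_div2 recursive_if_even recursive_if_zero recursive_if_mem

section \<open>Iteration and elementwise maps on list codes\<close>

lemma recursive_funpow:
  assumes "computable h" "recursive n f" "recursive n g"
  shows "recursive n (\<lambda>xs. (h ^^ f xs) (g xs))"
proof -
  have "computable (\<lambda>x. x)"
    unfolding computable_iff_recursive by (intro recursive_proj) simp
  then have "recursive 2 (\<lambda>xs. rec_nat (xs ! 1) (\<lambda>k y. h y) (xs ! 0))"
    by (rule recursive_rec_nat2) (intro recursive_comp1[OF assms(1)] recursive_proj, simp)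
  moreover have "rec_nat y (\<lambda>k y. h y) x = (h ^^ x) y" for x y
    by (induction x) auto
  ultimately show ?thesis
    using recursive_comp2[of "\<lambda>x y. (h ^^ x) y"] assms by simp
qed

definition map_code :: "(nat \<Rightarrow> nat) \<Rightarrow> nat \<Rightarrow> nat" where
  "map_code h c = list_encode (map h (list_decode c))"

lemma map_code_list_encode: "map_code h (list_encode xs) = list_encode (map h xs)"
  by (simp add: map_code_def)

text \<open>One step of mapping \<open>h\<close> over a list with an accumulator, which reverses the list.\<close>

definition rev_map_step :: "(nat \<Rightarrow> nat) \<Rightarrow> nat \<Rightarrow> nat" where
  "rev_map_step h s = (if fst (prod_decode s) = 0 then s
     else prod_encode (snd (prod_decode (fst (prod_decode s) - 1)),
       Suc (prod_encode (h (fst (prod_decode (fst (prod_decode s) - 1))), snd (prod_decode s)))))"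

text \<open>An exhausted list leaves the state unchanged, so iterating longer than the list does no
  harm; \<open>take\<close> and \<open>drop\<close> absorb the surplus.\<close>

lemma funpow_rev_map_step:
  "(rev_map_step h ^^ n) (prod_encode (list_encode xs, list_encode ys)) =
     prod_encode (list_encode (drop n xs), list_encode (rev (map h (take n xs)) @ ys))"
proof (induction n arbitrary: xs ys)
  case (Suc n)
  show ?case
  proof (cases xs)
    case Nil
    have "rev_map_step h (prod_encode (list_encode [], list_encode ys)) =
        prod_encode (list_encode [], list_encode ys)"
      by (simp add: rev_map_step_def)
    with Nil Suc.IH[of "[]" ys] show ?thesis by (simp add: funpow_swap1)
  next
    case (Cons x xs')
    have "rev_map_step h (prod_encode (list_encode xs, list_encode ys)) =
        prod_encode (list_encode xs', list_encode (h x # ys))"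
      by (simp add: rev_map_step_def Cons)
    with Cons Suc.IH[of xs' "h x # ys"] show ?thesis by (simp add: funpow_swap1)
  qed
qed simp

text \<open>Lets the code of a list serve as the number of iterations.\<close>

lemma length_le_list_encode: "length xs \<le> list_encode xs"
proof (induction xs)
  case (Cons x xs)
  then show ?case using le_prod_encode_2[of "list_encode xs" x] by simp
qed simp

lemma recursive_map_code:
  assumes "computable h" "recursive n f"
  shows "recursive n (\<lambda>xs. map_code h (f xs))"
proof -
  \<comment> \<open>The code \<open>c\<close> is itself a sufficient number of steps, and 0 codes
    the empty accumulator. A second pass with the identity undoes the reversal.\<close>
  define rev_map where
    "rev_map h c = snd (prod_decode ((rev_map_step h ^^ c) (prod_encode (c, 0))))" for h c
  have step: "computable (rev_map_step g)" if "computable g" for g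
    unfolding computable_iff_recursive rev_map_step_def
    by (intro recursive_intros recursive_comp1[OF that] recursive_proj) simp_all
  have rec: "recursive m (\<lambda>xs. rev_map g (e xs))" if "computable g" "recursive m e" for m g e
    unfolding rev_map_def using that
    by (intro recursive_snd recursive_funpow step recursive_prod_encode recursive_const)
  have rev_map: "rev_map g (list_encode xs) = list_encode (rev (map g xs))" for g xs
    unfolding rev_map_def
    using funpow_rev_map_step[of "list_encode xs" g xs "[]"] by (simp add: length_le_list_encode)
  have "map_code h c = rev_map (\<lambda>x. x) (rev_map h c)" for c
    using rev_map[of h "list_decode c"] rev_map[of "\<lambda>x. x" "rev (map h (list_decode c))"]
    by (simp add: map_code_def)
  moreover have "computable (\<lambda>x. x)"
    unfolding computable_iff_recursive by (intro recursive_proj) simp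
  ultimately show ?thesis using rec assms by simp
qed

lemma recursive_append_code:
  assumes "recursive n f"
  shows "recursive n (\<lambda>xs. list_encode (as @ list_decode (f xs)))"
proof (induction as)
  case (Cons a as)
  then show ?case
    unfolding append_Cons list_encode.simps
    by (intro recursive_Suc recursive_prod_encode recursive_const)
qed (simp add: assms)

section \<open>Renaming symbols\<close>

abbreviation rename :: "('f \<Rightarrow> 'g) \<Rightarrow> ('f, 'v) trm \<Rightarrow> ('g, 'v) trm" where
  "rename h \<equiv> map_trm h id"

lemma rename_id:
  "(\<And>f. f \<in> funs t \<Longrightarrow> h f = f) \<Longrightarrow> rename h t = t"
  by (induction t) (auto intro!: map_idI)

lemma rename_rename: "rename g (rename h t) = rename (g \<circ> h) t"
  by (simp add: trm.map_comp)

lemma rename_subst: "rename h (subst \<sigma> t) = subst (rename h \<circ> \<sigma>) (rename h t)"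
  by (induction t) auto

lemma rstep_rename:
  assumes "(s, t) \<in> rstep P"
  shows "(rename h s, rename h t) \<in> rstep (map_prod (rename h) (rename h) ` P)"
  using assms
proof induction
  case (root l r \<sigma>)
  then have "(rename h l, rename h r) \<in> map_prod (rename h) (rename h) ` P" by force
  then show ?case unfolding rename_subst by (rule rstep.root)
qed (simp add: rstep.arg)

section \<open>Rewriting steps and the symbols of terms\<close>

lemma rstep_mono: "(s, t) \<in> rstep P \<Longrightarrow> P \<subseteq> Q \<Longrightarrow> (s, t) \<in> rstep Q"
  by (induction rule: rstep.induct) (auto intro: rstep.intros)

text \<open>A loop \<open>Eps q q\<close> is an identity rule; a step with it changes nothing, which
  is how such loops disappear from runs.\<close>

lemma rstep_Un_Id: "(s, t) \<in> rstep (P \<union> Id) \<Longrightarrow> (s, t) \<in> (rstep P)\<^sup>="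
  by (induction rule: rstep.induct) (auto intro: rstep.intros)

lemma funs_subst: "funs (subst \<sigma> t) = funs t \<union> (\<Union>x \<in> vars t. funs (\<sigma> x))"
  by (induction t) auto

text \<open>Every symbol of \<open>l\<close> occurs in the redex \<open>subst \<sigma> l\<close>,
  hence in \<open>s\<close>. Rules with symbols foreign to \<open>s\<close> can thus be
  discarded.\<close>

lemma rstep_restrict_funs:
  "(s, t) \<in> rstep P \<Longrightarrow> (s, t) \<in> rstep {(l, r) \<in> P. funs l \<subseteq> funs s}"
proof (induction rule: rstep.induct)
  case (root l r \<sigma>)
  then show ?case by (intro rstep.root) (simp add: funs_subst)
next
  case (arg s t f us vs)
  have "(s, t) \<in> rstep {(l, r) \<in> P. funs l \<subseteq> funs (Fun f (us @ s # vs))}"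
    by (rule rstep_mono[OF arg.IH]) auto
  then show ?case by (rule rstep.arg)
qed

text \<open>Since \<open>vars r \<subseteq> vars l\<close>, a contractum takes its symbols from its
  redex or from the right-hand side.\<close>

lemma rstep_funs_subset:
  assumes "(s, t) \<in> rstep P" "\<And>l r. (l, r) \<in> P \<Longrightarrow> vars r \<subseteq> vars l \<and> funs r \<subseteq> G"
  shows "funs t \<subseteq> funs s \<union> G"
  using assms
proof induction
  case (root l r \<sigma>)
  then have "vars r \<subseteq> vars l" "funs r \<subseteq> G" by blast+
  then show ?case by (auto simp: funs_subst)
qed auto

lemma terms_rename:
  assumes "t \<in> terms G" "\<And>f. f \<in> funs t \<Longrightarrow> h f \<in> G' \<and> rank (h f) = rank f"
  shows "rename h t \<in> terms G'"
  using assms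
proof induction
  case (Fun f ts)
  have "rename h u \<in> terms G'" if "u \<in> set ts" for u
    using that Fun.IH[OF that] Fun.prems by (meson trm.set_intros(2))
  moreover have "h f \<in> G' \<and> rank (h f) = rank f" using Fun.prems[of f] by simp
  ultimately show ?case using Fun.hyps by (auto simp: id_def intro!: terms.Fun)
qed (auto intro: terms.Var)

lemma ground_terms_rename:
  assumes "t \<in> ground_terms G" "\<And>f. f \<in> funs t \<Longrightarrow> h f \<in> G' \<and> rank (h f) = rank f"
  shows "rename h t \<in> ground_terms G'"
  using assms terms_rename[of t G h G'] by (simp add: ground_terms_def trm.set_map)

lemma funs_terms: "t \<in> terms G \<Longrightarrow> funs t \<subseteq> G"
  by (induction rule: terms.induct) auto

lemma funs_ground_terms: "t \<in> ground_terms G \<Longrightarrow> funs t \<subseteq> G"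
  by (simp add: ground_terms_def funs_terms)

text \<open>Reduces renaming on codes of ground terms to an elementwise map on lists of symbol
  codes.\<close>

lemma polish_rename: "polish (rename h t) = map h (polish t)"
  by (induction t) (auto simp: map_concat intro!: arg_cong[of _ _ concat])

lemma funs_subset_sign: "(l, r) \<in> R \<Longrightarrow> funs l \<subseteq> sign R \<and> funs r \<subseteq> sign R"
  by (auto simp: sign_def)

text \<open>\<open>\<psi>\<close> is only a left inverse of \<open>\<phi>\<close>: the symbols of
  \<open>S\<close> lie outside \<open>range \<phi>\<close>, so undoing the renaming needs a separate
  case for them.\<close>

locale renaming =
  fixes R S :: trs and \<phi> \<psi> :: "symbol \<Rightarrow> symbol"
  assumes inverse: "\<psi> (\<phi> f) = f"
    and rank_\<phi>: "rank (\<phi> f) = rank f"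
    and fixed: "f \<in> sign R \<Longrightarrow> \<phi> f = f"
    and avoids: "\<phi> f \<notin> sign S"
    and vars_R: "(l, r) \<in> R \<Longrightarrow> vars r \<subseteq> vars l"
    and not_Var_S: "(l, r) \<in> S \<Longrightarrow> \<not> is_Var l"
begin

lemma rename_inverse: "rename \<psi> (rename \<phi> t) = t"
  by (simp add: rename_rename rename_id inverse)

lemma rename_range:
  assumes "funs t \<subseteq> range \<phi>"
  shows "rename \<phi> (rename \<psi> t) = t"
  unfolding rename_rename using assms inverse by (intro rename_id) auto

lemma map_rules:
  assumes "\<And>f. f \<in> sign R \<Longrightarrow> h f = f"
  shows "map_prod (rename h) (rename h) ` R = R"
proof -
  have "map_prod (rename h) (rename h) x = x" if "x \<in> R" for x
    using that assms by (cases x) (force simp: sign_def intro!: rename_id)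
  then show ?thesis by simp
qed

text \<open>The root symbol of a left-hand side of \<open>S\<close> belongs to
  \<open>sign S\<close>, so no such rule matches inside \<open>s\<close>. A variable left-hand side
  would match every term.\<close>

lemma rstep_disjoint_funs:
  assumes "(s, t) \<in> rstep (R \<union> S)" "funs s \<inter> sign S = {}"
  shows "(s, t) \<in> rstep R"
proof -
  have "False" if lr: "(l, r) \<in> S" "funs l \<subseteq> funs s" for l r
  proof -
    obtain f ts where "l = Fun f ts" using not_Var_S[OF lr(1)] by (cases l) auto
    then have "f \<in> funs l" by simp
    then show False using lr funs_subset_sign assms(2) by blast
  qed
  then show ?thesis
    by (intro rstep_mono[OF rstep_restrict_funs[OF assms(1)]]) auto
qed

text \<open>All symbols stay in the image of \<open>\<Gamma>\<close> under \<open>\<phi>\<close>,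
  which contains \<open>sign R\<close> and avoids \<open>sign S\<close>. Hence only rules of
  \<open>R\<close> fire, and these are fixed by \<open>\<psi>\<close>.\<close>

lemma rsteps_renamed:
  assumes "(s, t) \<in> (rstep (R \<union> S))\<^sup>*" "funs s \<subseteq> \<phi> ` \<Gamma>" "sign R \<subseteq> \<Gamma>"
  shows "funs t \<subseteq> \<phi> ` \<Gamma> \<and> (rename \<psi> s, rename \<psi> t) \<in> (rstep R)\<^sup>*"
  using assms(1)
proof induction
  case (step t u)
  have "sign R \<subseteq> \<phi> ` \<Gamma>" using assms(3) fixed by force
  then have rules: "vars r \<subseteq> vars l \<and> funs r \<subseteq> \<phi> ` \<Gamma>" if "(l, r) \<in> R" for l r
    using that vars_R by (fastforce simp: sign_def)
  have tu: "(t, u) \<in> rstep R"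
    using step avoids by (intro rstep_disjoint_funs) auto
  \<comment> \<open>\<open>\<psi>\<close> fixes \<open>sign R\<close> because \<open>\<phi>\<close>
    does and \<open>\<psi>\<close> inverts \<open>\<phi>\<close>.\<close>
  have "(rename \<psi> t, rename \<psi> u) \<in> rstep R"
    using rstep_rename[OF tu, of \<psi>] map_rules[of \<psi>] inverse fixed by metis
  with rstep_funs_subset[OF tu rules] step.IH show ?case
    by (blast intro: rtrancl_into_rtrancl)
qed (use assms in simp)

text \<open>From left to right, \<open>rsteps_renamed\<close> keeps the derivation free of symbols
  of \<open>S\<close> and \<open>\<psi>\<close> carries it back to \<open>\<Gamma>\<close>; the
  converse renames an \<open>R\<close>-derivation by \<open>\<phi>\<close>.\<close>

lemma descendants_rename:
  assumes "L \<subseteq> ground_terms \<Gamma>" "sign R \<subseteq> \<Gamma>"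
  shows "descendants (\<phi> ` \<Gamma> \<union> sign S) (R \<union> S) (rename \<phi> ` L) = rename \<phi> ` descendants \<Gamma> R L"
proof (intro equalityI subsetI)
  fix p assume "p \<in> descendants (\<phi> ` \<Gamma> \<union> sign S) (R \<union> S) (rename \<phi> ` L)"
  then obtain q where p: "p \<in> ground_terms (\<phi> ` \<Gamma> \<union> sign S)" and q: "q \<in> L"
    and qp: "(rename \<phi> q, p) \<in> (rstep (R \<union> S))\<^sup>*"
    by (auto simp: descendants_def)
  have "funs (rename \<phi> q) \<subseteq> \<phi> ` \<Gamma>"
    using q assms(1) funs_ground_terms by (fastforce simp: trm.set_map)
  from rsteps_renamed[OF qp this assms(2)]
  have funs: "funs p \<subseteq> \<phi> ` \<Gamma>" and steps: "(q, rename \<psi> p) \<in> (rstep R)\<^sup>*"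
    by (simp_all add: rename_inverse)
  have "rename \<psi> p \<in> ground_terms \<Gamma>"
  proof (rule ground_terms_rename[OF p])
    fix f assume "f \<in> funs p"
    with funs obtain g where "f = \<phi> g" "g \<in> \<Gamma>" by blast
    then show "\<psi> f \<in> \<Gamma> \<and> rank (\<psi> f) = rank f" by (simp add: inverse rank_\<phi>)
  qed
  with steps q have "rename \<psi> p \<in> descendants \<Gamma> R L" by (auto simp: descendants_def)
  moreover have "rename \<phi> (rename \<psi> p) = p" using funs by (intro rename_range) auto
  ultimately show "p \<in> rename \<phi> ` descendants \<Gamma> R L" by force
next
  fix p assume "p \<in> rename \<phi> ` descendants \<Gamma> R L"
  then obtain p' q where p: "p = rename \<phi> p'" "p' \<in> ground_terms \<Gamma>" and q: "q \<in> L"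
    and qp: "(q, p') \<in> (rstep R)\<^sup>*"
    by (auto simp: descendants_def)
  from qp have "(rename \<phi> q, rename \<phi> p') \<in> (rstep (R \<union> S))\<^sup>*"
  proof induction
    case (step t u)
    have "(rename \<phi> t, rename \<phi> u) \<in> rstep R"
      using rstep_rename[OF step(2), of \<phi>] map_rules[of \<phi>] fixed by metis
    then have "(rename \<phi> t, rename \<phi> u) \<in> rstep (R \<union> S)" by (rule rstep_mono) simp
    with step.IH show ?case by (rule rtrancl_into_rtrancl)
  qed simp
  moreover have "p \<in> ground_terms (\<phi> ` \<Gamma> \<union> sign S)"
    unfolding p(1) using p(2) funs_ground_terms by (intro ground_terms_rename) (auto simp: rank_\<phi>)
  ultimately show "p \<in> descendants (\<phi> ` \<Gamma> \<union> sign S) (R \<union> S) (rename \<phi> ` L)"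
    using p q by (auto simp: descendants_def)
qed

text \<open>Transitions on symbols of \<open>S\<close> are replaced by harmless loops instead of being removed, so that
  the translation of automata acts on each rule separately.\<close>

fun back_rule :: "bta_rule \<Rightarrow> bta_rule" where
  "back_rule (Trans f qs q) = (if f \<in> sign S then Eps q q else Trans (\<psi> f) qs q)"
| "back_rule (Eps q q') = Eps q q'"

definition back_bta :: "bta \<Rightarrow> bta" where
  "back_bta C = C\<lparr>rules := back_rule ` rules C\<rparr>"

lemma bta_over_back_bta:
  assumes "bta_over (\<phi> ` \<Gamma> \<union> sign S) C"
  shows "bta_over \<Gamma> (back_bta C)"
proof -
  have "rule_over \<Gamma> Q (back_rule \<rho>)" if "rule_over (\<phi> ` \<Gamma> \<union> sign S) Q \<rho>" for Q \<rho>
    using that by (cases \<rho>) (auto simp: inverse rank_\<phi>)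
  then show ?thesis using assms by (simp add: bta_over_def back_bta_def)
qed

section \<open>Runs of automata under renaming\<close>

lemma rename_state_trm: "rename (map_sum h id) (state_trm q) = state_trm q"
  by (simp add: state_trm_def)

lemma rename_rule_pair_Trans:
  "map_prod (rename (map_sum h id)) (rename (map_sum h id)) (rule_pair (Trans f qs q)) =
     rule_pair (Trans (h f) qs q)"
  by (simp add: rename_state_trm)

lemma rename_rule_pair_Eps:
  "map_prod (rename (map_sum h id)) (rename (map_sum h id)) (rule_pair (Eps q q')) =
     rule_pair (Eps q q')"
  by (simp add: rename_state_trm)

text \<open>Rules introduce no symbols other than states, so a run from a term without symbols of
  \<open>S\<close> never uses a transition on such a symbol; on the remaining rules
  \<open>back_rule\<close> acts as the renaming by \<open>\<psi>\<close>.\<close>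

lemma run_back:
  assumes "(s, t) \<in> (rstep (rule_pair ` P))\<^sup>*" "Inl ` sign S \<inter> funs s = {}"
  shows "Inl ` sign S \<inter> funs t = {} \<and>
    (rename (map_sum \<psi> id) s, rename (map_sum \<psi> id) t) \<in> (rstep (rule_pair ` back_rule ` P))\<^sup>*"
  using assms(1)
proof induction
  case (step t u)
  let ?h = "rename (map_sum \<psi> id)"
  have rules: "vars r \<subseteq> vars l \<and> funs r \<subseteq> range Inr" if "(l, r) \<in> rule_pair ` P" for l r
  proof -
    obtain \<rho> where "(l, r) = rule_pair \<rho>" using \<open>(l, r) \<in> rule_pair ` P\<close> by blast
    then show ?thesis by (cases \<rho>) (auto simp: state_trm_def)
  qed
  have "map_prod ?h ?h (l, r) \<in> rule_pair ` back_rule ` P"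
    if lr: "(l, r) \<in> rule_pair ` P" "funs l \<subseteq> funs t" for l r
  proof -
    obtain \<rho> where \<rho>: "(l, r) = rule_pair \<rho>" "\<rho> \<in> P" using lr(1) by blast
    have "map_prod ?h ?h (rule_pair \<rho>) = rule_pair (back_rule \<rho>)"
    proof (cases \<rho>)
      case (Trans f qs q)
      then have "Inl f \<in> funs t" using lr(2) \<rho>(1) by auto
      then have "f \<notin> sign S" using step.IH by blast
      then show ?thesis unfolding Trans rename_rule_pair_Trans by simp
    next
      case (Eps q q')
      show ?thesis unfolding Eps rename_rule_pair_Eps by simp
    qed
    with \<rho> show ?thesis by simp
  qed
  then have "(?h t, ?h u) \<in> rstep (rule_pair ` back_rule ` P)"
    by (intro rstep_mono[OF rstep_rename[OF rstep_restrict_funs[OF step(2)]]]) auto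
  moreover have "funs u \<subseteq> funs t \<union> range Inr"
    using step(2) rules by (rule rstep_funs_subset)
  ultimately show ?case using step.IH by (blast intro: rtrancl_into_rtrancl)
qed (use assms in simp)

text \<open>Inserted loops become identity rules; every other transition of \<open>P\<close> reads a
  symbol in the image of \<open>\<Gamma>\<close>, where \<open>\<phi> (\<psi> f) = f\<close>, so
  renaming restores the original rule.\<close>

lemma run_forth:
  assumes "(s, t) \<in> (rstep (rule_pair ` back_rule ` P))\<^sup>*"
    and over: "\<And>\<rho>. \<rho> \<in> P \<Longrightarrow> rule_over (\<phi> ` \<Gamma> \<union> sign S) Q \<rho>"
  shows "(rename (map_sum \<phi> id) s, rename (map_sum \<phi> id) t) \<in> (rstep (rule_pair ` P))\<^sup>*"
  using assms(1)
proof induction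
  case (step t u)
  let ?h = "rename (map_sum \<phi> id)"
  have rule: "map_prod ?h ?h (rule_pair (back_rule \<rho>)) \<in> rule_pair ` P \<union> Id" if "\<rho> \<in> P" for \<rho>
  proof (cases \<rho>)
    case (Trans f qs q)
    show ?thesis
    proof (cases "f \<in> sign S")
      case True
      then show ?thesis unfolding Trans by simp
    next
      case False
      then have "\<phi> (\<psi> f) = f" using over[OF that] Trans by (auto simp: inverse)
      then have "map_prod ?h ?h (rule_pair (back_rule \<rho>)) = rule_pair \<rho>"
        using False unfolding Trans back_rule.simps if_not_P[OF False] rename_rule_pair_Trans by simp
      then show ?thesis using that by simp
    qed
  next
    case (Eps q q')
    then show ?thesis using that unfolding Eps back_rule.simps rename_rule_pair_Eps by blast
  qed
  have "(?h t, ?h u) \<in> rstep (rule_pair ` P \<union> Id)"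
    using rstep_rename[OF step(2)] 
    by (rule rstep_mono) (simp only: image_image, intro image_subsetI rule)
  then have "(?h t, ?h u) \<in> (rstep (rule_pair ` P))\<^sup>=" by (rule rstep_Un_Id)
  then have "(?h t, ?h u) \<in> (rstep (rule_pair ` P))\<^sup>*" by auto
  with step.IH show ?case by (rule rtrancl_trans)
qed simp

text \<open>\<open>run_forth\<close> and \<open>run_back\<close> give the two directions, for
  \<open>map_sum \<phi> id\<close> turns \<open>Inl f\<close> into \<open>Inl (\<phi> f)\<close> and
  fixes the states.\<close>

lemma bta_lang_back_bta:
  assumes "bta_over (\<phi> ` \<Gamma> \<union> sign S) C"
  shows "bta_lang \<Gamma> (back_bta C) =
    {t \<in> ground_terms \<Gamma>. rename \<phi> t \<in> bta_lang (\<phi> ` \<Gamma> \<union> sign S) C}"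
proof -
  have "(rename Inl t, state_trm q) \<in> (rstep (rule_pair ` back_rule ` rules C))\<^sup>* \<longleftrightarrow>
      (rename Inl (rename \<phi> t), state_trm q) \<in> (rstep (rule_pair ` rules C))\<^sup>*" (is "?l \<longleftrightarrow> ?r")
    for t :: "(symbol, nat) trm" and q
  proof
    assume ?l
    then have "(rename (map_sum \<phi> id) (rename Inl t), rename (map_sum \<phi> id) (state_trm q))
        \<in> (rstep (rule_pair ` rules C))\<^sup>*"
      by (rule run_forth) (use assms in \<open>auto simp: bta_over_def\<close>)
    then show ?r by (simp add: rename_state_trm rename_rename comp_def)
  next
    assume ?r
    have disj: "Inl ` sign S \<inter> funs (rename Inl (rename \<phi> t)) = {}"
      using avoids by (auto simp: trm.set_map)
    with \<open>?r\<close> have "(rename (map_sum \<psi> id) (rename Inl (rename \<phi> t)), rename (map_sum \<psi> id) (state_trm q))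
        \<in> (rstep (rule_pair ` back_rule ` rules C))\<^sup>*"
      using run_back[OF _ disj] by blast
    then show ?l by (simp add: rename_state_trm rename_rename comp_def inverse)
  qed
  moreover have "rename \<phi> t \<in> ground_terms (\<phi> ` \<Gamma> \<union> sign S)" if "t \<in> ground_terms \<Gamma>" for t
    using that funs_ground_terms[OF that] by (intro ground_terms_rename) (auto simp: rank_\<phi>)
  ultimately show ?thesis
    by (auto simp: bta_lang_def back_bta_def)
qed

lemma bta_lang_back_bta_descendants:
  assumes "bta_over (\<phi> ` \<Gamma> \<union> sign S) C" "L \<subseteq> ground_terms \<Gamma>" "sign R \<subseteq> \<Gamma>"
    and "bta_lang (\<phi> ` \<Gamma> \<union> sign S) C = descendants (\<phi> ` \<Gamma> \<union> sign S) (R \<union> S) (rename \<phi> ` L)"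
  shows "bta_lang \<Gamma> (back_bta C) = descendants \<Gamma> R L"
proof -
  \<comment> \<open>By injectivity, \<open>rename \<phi> t\<close> is a renamed descendant only if
    \<open>t\<close> itself is a descendant.\<close>
  have "inj (rename \<phi>)" by (rule inj_on_inverseI) (rule rename_inverse)
  show ?thesis
    unfolding bta_lang_back_bta[OF assms(1)] assms(4) descendants_rename[OF assms(2,3)]
      inj_image_mem_iff[OF \<open>inj (rename \<phi>)\<close>]
    by (auto simp: descendants_def)
qed

end

section \<open>Transfer of the construction\<close>

text \<open>Presentations may contain repetitions, so \<open>k\<close> may identify elements, as
  \<open>back_rule\<close> can.\<close>

lemma set_code_map_code:
  assumes "set_code enc A c" "\<And>x. x \<in> A \<Longrightarrow> h (enc x) = enc' (k x)"
  shows "set_code enc' (k ` A) (map_code h c)"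
proof -
  obtain xs where "set xs = A" "c = list_encode (map enc xs)"
    using assms(1) unfolding set_code_def by blast
  then show ?thesis
    unfolding set_code_def using assms(2)
    by (intro exI[of _ "map k xs"]) (auto simp: map_code_list_encode intro!: arg_cong[of _ _ list_encode])
qed

text \<open>Formulated for one component so that both halves of the theorem follow by exchanging the
  two systems.\<close>

lemma EPRF_component:
  assumes \<Sigma>: "ranked_alphabet \<Sigma>" and \<Delta>: "ranked_alphabet \<Delta>" and disjoint: "\<Sigma> \<inter> \<Delta> = {}"
    and R: "is_trs \<Sigma> R" and S: "is_trs \<Delta> S"
    and not_Var: "\<forall>(l, r) \<in> S. \<not> is_Var l"
    and EPRF: "EPRF (R \<union> S)"
  shows "EPRF R"
proof -
  obtain F where F: "computable F"
    and F_correct: "\<forall>\<Gamma> L c. ranked_alphabet \<Gamma> \<and> sign (R \<union> S) \<subseteq> \<Gamma> \<and> finite L \<and>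
        L \<subseteq> ground_terms \<Gamma> \<and> input_code \<Gamma> L c \<longrightarrow>
        (\<exists>C. bta_over \<Gamma> C \<and> bta_code C (F c) \<and> bta_lang \<Gamma> C = descendants \<Gamma> (R \<union> S) L)"
    using EPRF unfolding EPRF_def by blast
  have "sign R \<subseteq> \<Sigma>" "sign S \<subseteq> \<Delta>"
    using R S funs_terms unfolding is_trs_def sign_def by fastforce+
  then have fin: "finite (sign R)" "finite (sign S)" and RS: "sign R \<inter> sign S = {}"
    using \<Sigma> \<Delta> disjoint by (auto simp: ranked_alphabet_def intro: finite_subset)
  \<comment> \<open>\<open>M\<close> exceeds every name in both signatures, so adding
    \<open>M\<close> to a name leaves \<open>sign R \<union> sign S\<close> while keeping the
    rank.\<close>
  obtain M where M: "\<And>f. f \<in> sign R \<union> sign S \<Longrightarrow> fst f < M"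
    using finite_nat_set_iff_bounded[of "fst ` (sign R \<union> sign S)"] fin by auto
  define \<phi> :: "symbol \<Rightarrow> symbol" where
    "\<phi> f = (if f \<in> sign R then f else (fst f + M, snd f))" for f
  \<comment> \<open>No shifted symbol lies in \<open>sign R\<close>, so the test recognizes which
    symbols to shift back.\<close>
  define \<psi> :: "symbol \<Rightarrow> symbol" where
    "\<psi> f = (if f \<in> sign R then f else (fst f - M, snd f))" for f
  have shifted: "(n + M, k) \<notin> sign R \<union> sign S" for n k
    using M[of "(n + M, k)"] by auto
  interpret renaming R S \<phi> \<psi>
  proof
    fix f
    show "\<psi> (\<phi> f) = f" and "\<phi> f \<notin> sign S"
      using shifted[of "fst f" "snd f"] RS by (auto simp: \<phi>_def \<psi>_def)
  qed (use R not_Var in \<open>auto simp: \<phi>_def rank_def is_trs_def\<close>)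

  define \<phi>c where "\<phi>c x = (if x \<in> prod_encode ` sign R then x
      else prod_encode (fst (prod_decode x) + M, snd (prod_decode x)))" for x
  define \<psi>c where "\<psi>c x = (if x \<in> prod_encode ` sign R then x
      else prod_encode (fst (prod_decode x) - M, snd (prod_decode x)))" for x
  \<comment> \<open>Mirrors \<open>back_rule\<close>: an even code is twice the code of
    \<open>(f, (qs, q))\<close> for a \<open>Trans\<close>; for \<open>f\<close> in
    \<open>sign S\<close> it becomes the odd code of \<open>Eps q q\<close>. Sums of equal terms
    stand for doubling.\<close>
  define \<rho>c where "\<rho>c x = (if even x
      then if fst (prod_decode (x div 2)) \<in> prod_encode ` sign S
        then Suc (prod_encode (snd (prod_decode (snd (prod_decode (x div 2)))),
            snd (prod_decode (snd (prod_decode (x div 2)))))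
          + prod_encode (snd (prod_decode (snd (prod_decode (x div 2)))),
            snd (prod_decode (snd (prod_decode (x div 2))))))
        else prod_encode (\<psi>c (fst (prod_decode (x div 2))), snd (prod_decode (x div 2)))
          + prod_encode (\<psi>c (fst (prod_decode (x div 2))), snd (prod_decode (x div 2)))
      else x)" for x
  \<comment> \<open>A fixed listing of \<open>sign S\<close>, part of the algorithm and not of its
    input.\<close>
  obtain ss where ss: "set ss = sign S" using finite_list[OF fin(2)] by blast
  \<comment> \<open>Codes of terms are lists of symbol codes, so renaming the set \<open>L\<close>
    maps at two levels.\<close>
  define pre where "pre c = prod_encode
      (list_encode (map prod_encode ss @ list_decode (map_code \<phi>c (fst (prod_decode c)))),
       map_code (map_code \<phi>c) (snd (prod_decode c)))" for c
  \<comment> \<open>Only the rules change; states and final states are passed on.\<close>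
  define post where "post c = prod_encode (fst (prod_decode c),
      prod_encode (map_code \<rho>c (fst (prod_decode (snd (prod_decode c)))),
        snd (prod_decode (snd (prod_decode c)))))" for c

  have comp_\<phi>c: "computable \<phi>c"
    unfolding computable_iff_recursive \<phi>c_def
    by (intro recursive_intros recursive_const recursive_proj finite_imageI fin) simp_all
  have comp_\<psi>c: "computable \<psi>c"
    unfolding computable_iff_recursive \<psi>c_def
    by (intro recursive_intros recursive_const recursive_proj finite_imageI fin) simp_all
  have comp_\<rho>c: "computable \<rho>c"
    unfolding computable_iff_recursive \<rho>c_def
    by (intro recursive_intros recursive_comp1[OF comp_\<psi>c] recursive_proj finite_imageI fin) simp_all
  have "computable (map_code \<phi>c)"
    unfolding computable_iff_recursive by (intro recursive_map_code comp_\<phi>c recursive_proj) simp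
  then have "computable pre"
    unfolding computable_iff_recursive[of pre] pre_def using comp_\<phi>c
    by (intro recursive_intros recursive_append_code recursive_map_code recursive_proj) simp_all
  then have comp_F_pre: "recursive 1 (\<lambda>xs. F (pre (xs ! 0)))"
    by (intro recursive_comp1[OF F]) (simp add: computable_iff_recursive)
  have "computable post"
    unfolding computable_iff_recursive post_def
    by (intro recursive_intros recursive_map_code[OF comp_\<rho>c] recursive_proj) simp_all
  then have computable: "computable (\<lambda>c. post (F (pre c)))"
    unfolding computable_iff_recursive[of "\<lambda>c. post (F (pre c))"]
    using comp_F_pre by (rule recursive_comp1)

  have mem: "prod_encode f \<in> prod_encode ` A \<longleftrightarrow> f \<in> A" for f :: symbol and A
    by (rule inj_image_mem_iff) (rule inj_prod_encode)
  have \<phi>c: "\<phi>c (prod_encode f) = prod_encode (\<phi> f)" for f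
    by (simp add: \<phi>c_def \<phi>_def mem)
  have \<psi>c: "\<psi>c (prod_encode f) = prod_encode (\<psi> f)" for f
    by (simp add: \<psi>c_def \<psi>_def mem)
  have \<rho>c: "\<rho>c (rule_code \<rho>) = rule_code (back_rule \<rho>)" for \<rho>
    by (cases \<rho>) (simp_all add: \<rho>c_def sum_encode_def mem \<psi>c mult_2)
  have ground: "map_code \<phi>c (ground_code t) = ground_code (rename \<phi> t)" for t
    by (simp add: ground_code_def map_code_list_encode polish_rename \<phi>c comp_def)

  have "\<exists>C. bta_over \<Gamma> C \<and> bta_code C (post (F (pre c))) \<and> bta_lang \<Gamma> C = descendants \<Gamma> R L"
    if \<Gamma>: "ranked_alphabet \<Gamma>" and sign: "sign R \<subseteq> \<Gamma>" and L: "finite L" "L \<subseteq> ground_terms \<Gamma>"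
      and c: "input_code \<Gamma> L c" for \<Gamma> L c
  proof -
    let ?\<Gamma> = "\<phi> ` \<Gamma> \<union> sign S"
    obtain a b where ab: "set_code prod_encode \<Gamma> a" "set_code ground_code L b"
      "c = prod_encode (a, b)" using c unfolding input_code_def by blast
    obtain gs where gs: "set gs = \<phi> ` \<Gamma>" "map_code \<phi>c a = list_encode (map prod_encode gs)"
      using set_code_map_code[of prod_encode \<Gamma> a \<phi>c prod_encode \<phi>, OF ab(1) \<phi>c]
      unfolding set_code_def by blast
    have "set_code prod_encode ?\<Gamma> (list_encode (map prod_encode ss @ list_decode (map_code \<phi>c a)))"
      unfolding set_code_def by (rule exI[of _ "ss @ gs"]) (auto simp: gs ss)
    moreover have "set_code ground_code (rename \<phi> ` L) (map_code (map_code \<phi>c) b)"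
      using ab(2) ground by (rule set_code_map_code)
    ultimately have "input_code ?\<Gamma> (rename \<phi> ` L) (pre c)"
      unfolding input_code_def pre_def ab(3) prod_encode_inverse fst_conv snd_conv by blast
    moreover have "ranked_alphabet ?\<Gamma>" using \<Gamma> fin by (simp add: ranked_alphabet_def)
    moreover have "sign (R \<union> S) \<subseteq> ?\<Gamma>"
    proof -
      have "sign R \<subseteq> \<phi> ` \<Gamma>" using sign fixed by force
      then show ?thesis by (auto simp: sign_def)
    qed
    moreover have "rename \<phi> ` L \<subseteq> ground_terms ?\<Gamma>"
    proof
      fix u assume "u \<in> rename \<phi> ` L"
      then obtain t where t: "u = rename \<phi> t" "t \<in> ground_terms \<Gamma>" using L(2) by blast
      show "u \<in> ground_terms ?\<Gamma>"
        unfolding t(1) using t(2) funs_ground_terms[OF t(2)]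
        by (intro ground_terms_rename) (auto simp: rank_\<phi>)
    qed
    \<comment> \<open>The automaton that \<open>F\<close> computes on the renamed input;
      \<open>post\<close> replaces it by \<open>back_bta C\<close>.\<close>
    ultimately obtain C where over: "bta_over ?\<Gamma> C" and code: "bta_code C (F (pre c))"
      and lang: "bta_lang ?\<Gamma> C = descendants ?\<Gamma> (R \<union> S) (rename \<phi> ` L)"
      using F_correct L(1) by blast
    obtain a' b' d' where abd: "set_code id (states C) a'" "set_code rule_code (rules C) b'"
      "set_code id (finals C) d'" "F (pre c) = prod_encode (a', prod_encode (b', d'))"
      using code unfolding bta_code_def by blast
    have "set_code rule_code (back_rule ` rules C) (map_code \<rho>c b')"
      using abd(2) \<rho>c by (rule set_code_map_code)
    then have "bta_code (back_bta C) (post (F (pre c)))"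
      using abd(1,3) unfolding bta_code_def abd(4) post_def back_bta_def by auto
    with bta_over_back_bta[OF over] bta_lang_back_bta_descendants[OF over L(2) sign lang]
    show ?thesis by blast
  qed
  with computable show ?thesis
    unfolding EPRF_def by (intro exI[of _ "\<lambda>c. post (F (pre c))"]) blast
qed

theorem mainTheorem19:
  fixes R S :: trs and \<Sigma> \<Delta> :: "symbol set"
  assumes "ranked_alphabet \<Sigma>" and "ranked_alphabet \<Delta>" and "\<Sigma> \<inter> \<Delta> = {}"
    and "is_trs \<Sigma> R" and "is_trs \<Delta> S"
    and "\<forall>(l, r) \<in> R \<union> S. \<not> is_Var l"
    and "EPRF (R \<union> S)"
  shows "EPRF R \<and> EPRF S"
proof
  show "EPRF R"
    using assms by (intro EPRF_component[of \<Sigma> \<Delta> R S]) auto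
  show "EPRF S"
    using assms by (intro EPRF_component[of \<Delta> \<Sigma> S R]) (auto simp: Un_commute)
qed

end
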